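(* Let $n\ge 2$ and let $a\in C_n\cap\mathbb{R}^n_{\ge 0}$. Then there is a $p\in C_n\cap \mathrm{sl}(n)\cap\mathbb{R}^n_{\ge 0}$ with $d_a(p)\le d_a(q)$ for all $q\in \mathrm{sl}(n)$.
   Context: $\mathbb{R}^n_{\ge 0}=\{x\in\mathbb{R}^n : x_i\ge 0 \text{ for all } i\}$. The set $\mathrm{sl}(n)$ (not the Lie algebra) is $\mathrm{sl}(n)=\{x\in\mathbb{R}^n : \prod_{i=1}^n x_i=1\}$. The order cone is $C_n=\{x\in\mathbb{R}^n : x_1\ge x_2\ge\dots\ge x_n\}$. For $a\in\mathbb{R}^n$, $d_a(p)=\frac12\|p-a\|_2^2$ is (half) the squared Euclidean distance. *)

theory Defs
  imports "HOL-Analysis.Analysis"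
begin

text \<open>
  Vectors in $\mathbb{R}^n$ are elements of \<^typ>\<open>real ^ 'n\<close> with $n$ = \<open>CARD('n)\<close>.
  The order cone refers to the order $1 < 2 < \dots < n$ of the coordinates, so the index type is
  required to be a finite linear order; such a type is order-isomorphic to $\{1, \dots, n\}$.
\<close>

definition nonneg_orthant :: "(real ^ 'n) set" where
  "nonneg_orthant = {x. \<forall>i. 0 \<le> x $ i}"

definition sl :: "(real ^ 'n) set" where
  "sl = {x. (\<Prod>i\<in>UNIV. x $ i) = 1}"

definition order_cone :: "(real ^ 'n::{finite,linorder}) set" where
  "order_cone = {x. \<forall>i j. i \<le> j \<longrightarrow> x $ i \<ge> x $ j}"

definition half_sqdist :: "real ^ 'n \<Rightarrow> real ^ 'n \<Rightarrow> real" where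
  "half_sqdist a p = 1 / 2 * (norm (p - a))\<^sup>2"

end

theory Submission imports Defs "HOL-Combinatorics.Transposition" begin

text \<open>
  The set \<open>sl\<close> is closed, so it contains a nearest point to \<open>a\<close>, and replacing its coordinates by
  their absolute values does not increase the distance because \<open>a\<close> is nonnegative. The nonnegative
  nearest points form a compact set; take one that maximizes the inner product with a strictly
  decreasing vector \<open>r\<close>. If two of its coordinates were in the wrong order, exchanging them would not
  increase the distance to the decreasing vector \<open>a\<close>, but would strictly increase the product with
  \<open>r\<close>. The vector \<open>r\<close> is needed because \<open>a\<close> may have equal coordinates.
\<close>

lemma closed_sl: "closed (sl :: (real ^ 'n) set)"
  unfolding sl_def by (intro closed_Collect_eq continuous_intros)

lemma closed_nonneg_orthant: "closed (nonneg_orthant :: (real ^ 'n) set)"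
  unfolding nonneg_orthant_def by (intro closed_Collect_all closed_Collect_le continuous_intros)

lemma abs_vec_in_sl:
  assumes "p \<in> sl"
  shows "(\<chi> k. \<bar>p $ k\<bar>) \<in> sl"
  using assms by (simp add: sl_def flip: abs_prod)

text \<open>In each coordinate this is the reverse triangle inequality, since \<open>a $ i\<close>
  equals its own absolute value.\<close>

lemma dist_abs_vec_le:
  fixes a p :: "real ^ 'n"
  assumes "a \<in> nonneg_orthant"
  shows "dist a (\<chi> k. \<bar>p $ k\<bar>) \<le> dist a p"
  unfolding dist_norm
proof (rule norm_le_componentwise_cart)
  fix i
  have "0 \<le> a $ i"
    using assms by (simp add: nonneg_orthant_def)
  then show "norm ((a - (\<chi> k. \<bar>p $ k\<bar>)) $ i) \<le> norm ((a - p) $ i)"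
    by simp
qed

definition swap_coords :: "'n \<Rightarrow> 'n \<Rightarrow> real ^ 'n \<Rightarrow> real ^ 'n" where
  "swap_coords i j p = (\<chi> k. p $ Transposition.transpose i j k)"

lemma swap_coords_in_sl:
  assumes "p \<in> sl"
  shows "swap_coords i j p \<in> sl"
  using assms prod.reindex_bij_betw[OF bij_transpose, of "\<lambda>k. p $ k" i j]
  by (simp add: sl_def swap_coords_def)

lemma swap_coords_in_nonneg_orthant:
  "p \<in> nonneg_orthant \<Longrightarrow> swap_coords i j p \<in> nonneg_orthant"
  by (simp add: nonneg_orthant_def swap_coords_def)

lemma inner_swap_coords_self: "swap_coords i j p \<bullet> swap_coords i j p = p \<bullet> p"
  using sum.reindex_bij_betw[OF bij_transpose, of "\<lambda>k. p $ k * p $ k" i j]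
  by (simp add: inner_vec_def swap_coords_def)

text \<open>The transposition fixes all indices except \<open>i\<close> and \<open>j\<close>, so
  only two summands change. The formula serves both for the distance to \<open>a\<close> and for the
  product with \<open>r\<close>.\<close>

lemma inner_swap_coords:
  fixes c p :: "real ^ 'n"
  assumes "i \<noteq> j"
  shows "c \<bullet> swap_coords i j p = c \<bullet> p + (c $ i - c $ j) * (p $ j - p $ i)"
proof -
  have "c \<bullet> swap_coords i j p - c \<bullet> p
      = (\<Sum>k\<in>UNIV. c $ k * (p $ Transposition.transpose i j k - p $ k))"
    by (simp add: inner_vec_def swap_coords_def sum_subtractf algebra_simps)
  also have "\<dots> = (\<Sum>k\<in>{i, j}. c $ k * (p $ Transposition.transpose i j k - p $ k))"
    by (rule sum.mono_neutral_right) auto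
  also have "\<dots> = (c $ i - c $ j) * (p $ j - p $ i)"
    using assms by (simp add: algebra_simps)
  finally show ?thesis by simp
qed

text \<open>A swap preserves the norm of \<open>p\<close>, so in the expanded squared distance only
  the inner product with \<open>a\<close> changes, and it does not decrease.\<close>

lemma dist_swap_coords_le:
  fixes a p :: "real ^ 'n"
  assumes "i \<noteq> j" "a $ j \<le> a $ i" "p $ i \<le> p $ j"
  shows "dist a (swap_coords i j p) \<le> dist a p"
proof -
  have "a \<bullet> p \<le> a \<bullet> swap_coords i j p"
    using assms by (simp add: inner_swap_coords)
  then show ?thesis
    unfolding dist_norm norm_le
    by (simp add: inner_diff_left inner_diff_right inner_swap_coords_self inner_commute)
qed

theorem lemma3p5:
  fixes a :: "real ^ 'n::{finite,linorder}"
  assumes "CARD('n) \<ge> 2"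
    and "a \<in> order_cone \<inter> nonneg_orthant"
  shows "\<exists>p \<in> order_cone \<inter> sl \<inter> nonneg_orthant. \<forall>q \<in> sl. half_sqdist a p \<le> half_sqdist a q"
proof -
  have a_cone: "a $ j \<le> a $ i" if "i \<le> j" for i j
    using assms(2) that by (auto simp: order_cone_def)
  have a_nonneg: "a \<in> nonneg_orthant"
    using assms(2) by simp
  \<comment> \<open>The infimum of the distance is attained only if \<open>sl\<close> is
    nonempty.\<close>
  have "(\<chi> k. 1) \<in> (sl :: (real ^ 'n::{finite,linorder}) set)"
    by (simp add: sl_def)
  then obtain s where s: "s \<in> sl" "\<And>q. q \<in> sl \<Longrightarrow> dist a s \<le> dist a q"
    using distance_attains_inf[OF closed_sl, of a] by blast
  \<comment> \<open>The radius is the minimal distance, so the ball meets \<open>sl\<close> exactly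
    in the nearest points; it also makes \<open>M\<close> bounded.\<close>
  define M where "M = sl \<inter> nonneg_orthant \<inter> cball a (dist a s)"
  have "compact M"
    unfolding M_def by (intro closed_Int_compact closed_Int closed_sl closed_nonneg_orthant compact_cball)
  moreover have "(\<chi> k. \<bar>s $ k\<bar>) \<in> M"
    using s(1) abs_vec_in_sl dist_abs_vec_le[OF a_nonneg, of s]
    by (auto simp: M_def nonneg_orthant_def)
  \<comment> \<open>Counting the indices from \<open>i\<close> upwards gives a strictly decreasing
    vector: for \<open>i < j\<close> the set \<open>{j..}\<close> lacks \<open>i\<close>.\<close>
  moreover define r :: "real ^ 'n::{finite,linorder}" where "r = (\<chi> i. real (card {i..}))"
  have "continuous_on M (\<lambda>p. r \<bullet> p)"
    by (intro continuous_intros)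
  ultimately obtain p where p: "p \<in> M" and p_max: "\<And>q. q \<in> M \<Longrightarrow> r \<bullet> q \<le> r \<bullet> p"
    using continuous_attains_sup[of M "\<lambda>p. r \<bullet> p"] by blast
  have "p $ j \<le> p $ i" if "i \<le> j" for i j
  proof (rule ccontr)
    assume "\<not> p $ j \<le> p $ i"
    then have lt: "p $ i < p $ j" and "i < j"
      using that by (auto simp: less_le)
    have "dist a (swap_coords i j p) \<le> dist a p"
      using a_cone[OF that] lt \<open>i < j\<close> by (intro dist_swap_coords_le) auto
    then have "swap_coords i j p \<in> M"
      using p by (auto simp: M_def swap_coords_in_sl swap_coords_in_nonneg_orthant)
    moreover have "r $ j < r $ i"
      using \<open>i < j\<close> by (auto simp: r_def intro!: psubset_card_mono)
    \<comment> \<open>The gain is a product of two positive factors, \<open>r $ i - r $ j\<close>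
      and \<open>p $ j - p $ i\<close>.\<close>
    then have "r \<bullet> p < r \<bullet> swap_coords i j p"
      using lt \<open>i < j\<close> by (simp add: inner_swap_coords)
    ultimately show False
      using p_max by fastforce
  qed
  then have "p \<in> order_cone \<inter> sl \<inter> nonneg_orthant"
    using p by (auto simp: order_cone_def M_def)
  moreover have "half_sqdist a p \<le> half_sqdist a q" if "q \<in> sl" for q
  proof -
    have "dist a p \<le> dist a q"
      using p s(2)[OF that] by (auto simp: M_def)
    then show ?thesis
      by (simp add: half_sqdist_def dist_norm norm_minus_commute)
  qed
  ultimately show ?thesis by blast
qed

end
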